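(* Let $\mathbf{k}$ be a field with $\mathrm{char}(\mathbf{k}) > d$, let $n \geq 1$, let $\alpha_1,\dots,\alpha_d \in M_n(\mathbf{k})$, and put $T = x_1\alpha_1 + \dots + x_d\alpha_d \in M_n(\mathbf{k}\langle x_1,\dots,x_d\rangle)$. Suppose that \[ \chi_d(T) := \sum_{\sigma\in S_d}(T - x_{\sigma(1)})(T - x_{\sigma(2)})\cdots(T - x_{\sigma(d)}) = 0 \quad \text{in } M_n(\mathbf{k}\langle x_1,\dots,x_d\rangle). \] Then: (1) for some $i \in \{1,\dots,d\}$, $\alpha_i$ has an eigenvector with eigenvalue $1$; and (2) for every $i$, if $m \in \mathbf{k}^n$ satisfies $\alpha_i m = m$, then $\alpha_j m = 0$ for all $j \neq i$.
   Context: $\mathbf{k}\langle x_1,\dots,x_d\rangle$ is the free associative $\mathbf{k}$-algebra on $x_1,\dots,x_d$; in $M_n(\mathbf{k}\langle x_1,\dots,x_d\rangle)$ the scalars $x_i$ commute with the constant matrices $\alpha_j$, and $x_{\sigma(j)}$ denotes the scalar matrix $x_{\sigma(j)}\cdot I_n$. The product over $j=1,\dots,d$ is taken in that order. *)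

theory Defs
  imports "HOL-Analysis.Analysis"
begin

text \<open>Matrices over the free associative algebra k<x_1,...,x_d>.
  An element of M_n(k<x_1..x_d>) is represented by its coefficient family:
  for each word w (a list of variable indices) the n x n matrix over k
  standing in front of the monomial x_w.  Multiplication is the
  convolution along concatenation of words (variables commute with
  constant matrices but not with each other).\<close>

type_synonym ('a, 'n) ncmat = "nat list \<Rightarrow> 'a ^ 'n ^ 'n"

definition nc_mult :: "('a::field, 'n::finite) ncmat \<Rightarrow> ('a, 'n) ncmat \<Rightarrow> ('a, 'n) ncmat" where
  "nc_mult P Q = (\<lambda>w. \<Sum>k\<le>length w. P (take k w) ** Q (drop k w))"

definition nc_diff :: "('a::field, 'n::finite) ncmat \<Rightarrow> ('a, 'n) ncmat \<Rightarrow> ('a, 'n) ncmat" where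
  "nc_diff P Q = (\<lambda>w. P w - Q w)"

definition nc_sum :: "('b \<Rightarrow> ('a::field, 'n::finite) ncmat) \<Rightarrow> 'b set \<Rightarrow> ('a, 'n) ncmat" where
  "nc_sum f A = (\<lambda>w. \<Sum>i\<in>A. f i w)"

text \<open>constant matrix alpha in M_n(k) \<subseteq> M_n(k<x>)\<close>
definition nc_const :: "'a::field ^ 'n::finite ^ 'n \<Rightarrow> ('a, 'n) ncmat" where
  "nc_const A = (\<lambda>w. if w = [] then A else 0)"

text \<open>the scalar matrix x_i * I_n\<close>
definition nc_var :: "nat \<Rightarrow> ('a::field, 'n::finite) ncmat" where
  "nc_var i = (\<lambda>w. if w = [i] then mat 1 else 0)"

definition nc_zero :: "('a::field, 'n::finite) ncmat" where
  "nc_zero = (\<lambda>w. 0)"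

text \<open>ordered product P_1 P_2 ... P_m (left to right)\<close>
definition nc_prod_list :: "('a::field, 'n::finite) ncmat list \<Rightarrow> ('a, 'n) ncmat" where
  "nc_prod_list Ps = foldr nc_mult Ps (nc_const (mat 1))"

text \<open>T = x_1 alpha_1 + ... + x_d alpha_d\<close>
definition T_mat :: "nat \<Rightarrow> (nat \<Rightarrow> 'a::field ^ 'n::finite ^ 'n) \<Rightarrow> ('a, 'n) ncmat" where
  "T_mat d \<alpha> = nc_sum (\<lambda>i. nc_mult (nc_var i) (nc_const (\<alpha> i))) {1..d}"

text \<open>chi_d(T) = sum over sigma in S_d of (T - x_sigma(1)) ... (T - x_sigma(d))\<close>
definition chi :: "nat \<Rightarrow> (nat \<Rightarrow> 'a::field ^ 'n::finite ^ 'n) \<Rightarrow> ('a, 'n) ncmat" where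
  "chi d \<alpha> = nc_sum
     (\<lambda>\<sigma>. nc_prod_list (map (\<lambda>j. nc_diff (T_mat d \<alpha>) (nc_var (\<sigma> j))) [1..<d+1]))
     {\<sigma>. \<sigma> permutes {1..d}}"

end

theory Submission
  imports Defs "HOL-Computational_Algebra.Polynomial"
begin

text \<open>Every factor T - x_j of \<chi>_d(T) is linear in the variables, so the coefficient of a word
  x_a1 ... x_ad in a product of such factors is the corresponding product of constant matrices.

  (2) Apply the coefficient of x_j x_i^(d-1) to a vector m with \<alpha>_i m = m: the factor
  \<alpha>_i - \<delta> attached to a letter x_i kills m exactly when the permutation puts i at that
  position, so only the (d-1)! permutations with \<sigma>(1) = i survive, each contributing \<alpha>_j m.

  (1) Substitute for x_a the Lagrange polynomial t_a in one commuting variable s, with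
  t_a(b) = \<delta>_ab on {1..d} (this needs char > d). The factors become the pairwise commuting
  matrices M - t_j I with M = \<Sum>_a t_a \<alpha>_a, so \<chi>_d(T) = 0 turns into d! \<Prod>_j (M - t_j I) = 0 over
  k[s]. Taking determinants in the domain k[s], some det (M - t_k I) vanishes, and evaluating it
  at s = k gives det (\<alpha>_k - I) = 0.\<close>

section \<open>Matrix algebra\<close>

lemma matrix_vector_mult_sum_left:
  "(\<Sum>x\<in>S. A x) *v v = (\<Sum>x\<in>S. A x *v (v :: 'a::semiring_1^'n::finite))"
  by (induction S rule: infinite_finite_induct) (auto simp: matrix_vector_mult_add_rdistrib)

lemma matrix_add_rdistrib: "(A + B) ** C = A ** C + B ** C"
  by (vector matrix_matrix_mult_def sum.distrib[symmetric] field_simps)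

lemma matrix_diff_rdistrib: "((A::'a::ring_1^'n::finite^'m::finite) - B) ** C = A ** C - B ** C"
  by (vector matrix_matrix_mult_def sum_subtractf[symmetric] field_simps)

lemma matrix_diff_ldistrib: "(A::'a::ring_1^'n::finite^'m::finite) ** (B - C) = A ** B - A ** C"
  by (vector matrix_matrix_mult_def sum_subtractf[symmetric] field_simps)

lemma matrix_sum_rdistrib: "(\<Sum>x\<in>S. A x) ** B = (\<Sum>x\<in>S. A x ** B)"
  by (induction S rule: infinite_finite_induct) (auto simp: matrix_add_rdistrib)

lemma matrix_sum_ldistrib: "A ** (\<Sum>x\<in>S. B x) = (\<Sum>x\<in>S. A ** B x)"
  by (induction S rule: infinite_finite_induct) (auto simp: matrix_add_ldistrib)

lemma mat_matrix_mult_commute: "mat c ** (A::'a::comm_semiring_1^'n::finite^'n) = A ** mat c"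
  unfolding matrix_matrix_mult_def mat_def
  by (simp add: vec_eq_iff if_distrib if_distribR sum.delta sum.delta' mult.commute cong: if_cong)

lemma diff_mat_commute:
  "(A - mat a) ** (A - mat b) = (A - mat b) ** (A - mat (a::'a::comm_ring_1) :: 'a^'n::finite^'n)"
proof -
  have "mat a ** A = A ** mat a" "mat b ** A = A ** mat b"
    "mat a ** mat b = mat b ** (mat a :: 'a^'n^'n)"
    by (rule mat_matrix_mult_commute)+
  then show ?thesis
    by (simp only: matrix_diff_ldistrib matrix_diff_rdistrib) (simp add: algebra_simps)
qed

abbreviation mat_prod_list :: "('a::semiring_1^'n::finite^'n) list \<Rightarrow> 'a^'n^'n" where
  "mat_prod_list As \<equiv> foldr (**) As (mat 1)"

lemma mat_prod_list_append: "mat_prod_list (As @ Bs) = mat_prod_list As ** mat_prod_list Bs"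
  by (induction As) (simp_all add: matrix_mul_assoc)

lemma mat_prod_list_commute:
  "(\<And>B. B \<in> set Bs \<Longrightarrow> A ** B = B ** A) \<Longrightarrow> A ** mat_prod_list Bs = mat_prod_list Bs ** A"
proof (induction Bs)
  case (Cons B Bs)
  then have "A ** (B ** mat_prod_list Bs) = B ** (A ** mat_prod_list Bs)"
    by (metis list.set_intros(1) matrix_mul_assoc)
  also have "\<dots> = (B ** mat_prod_list Bs) ** A"
    using Cons by (simp add: matrix_mul_assoc[symmetric])
  finally show ?case by simp
qed simp

lemma mat_prod_list_perm:
  assumes "mset As = mset Bs" and "\<And>A B. A \<in> set As \<Longrightarrow> B \<in> set As \<Longrightarrow> A ** B = B ** A"
  shows "mat_prod_list As = mat_prod_list Bs"
  using assms
proof (induction As arbitrary: Bs)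
  case (Cons A As)
  have set_eq: "set (A # As) = set Bs" using mset_eq_setD[OF Cons.prems(1)] .
  then obtain Bs1 Bs2 where Bs: "Bs = Bs1 @ A # Bs2" by (metis list.set_intros(1) split_list)
  have mset: "mset As = mset (Bs1 @ Bs2)" using Cons.prems(1) Bs by simp
  have "A ** mat_prod_list Bs1 = mat_prod_list Bs1 ** A"
    using Cons.prems(2) set_eq Bs by (intro mat_prod_list_commute) auto
  then have "mat_prod_list Bs = (A ** mat_prod_list Bs1) ** mat_prod_list Bs2"
    by (simp del: foldr_append add: Bs mat_prod_list_append matrix_mul_assoc)
  also have "\<dots> = A ** mat_prod_list As"
    using Cons.IH[OF mset] Cons.prems(2)
    by (simp del: foldr_append add: mat_prod_list_append matrix_mul_assoc)
  finally show ?case by simp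
qed simp

lemma det_mat_prod_list:
  "det (mat_prod_list As) = prod_list (map det (As :: ('a::comm_ring_1^'n::finite^'n) list))"
  by (induction As) (simp_all add: det_mul)

lemma poly_det:
  "poly (det X) x = det (map_matrix (\<lambda>p. poly p x) (X :: 'a::comm_ring_1 poly^'n::finite^'n))"
  unfolding det_def by (simp add: map_matrix_def poly_sum poly_prod of_int_poly)

lemma det_eq_0_imp_kernel:
  fixes A :: "'a::field^'n::finite^'n"
  assumes "det A = 0"
  shows "\<exists>v. v \<noteq> 0 \<and> A *v v = 0"
proof (rule ccontr)
  assume "\<nexists>v. v \<noteq> 0 \<and> A *v v = 0"
  then obtain B where "B ** A = mat 1"
    using matrix_left_invertible_ker by blast
  then have "det B * det A = 1" by (metis det_mul det_I)
  with assms show False by simp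
qed

lemma sum_const_vec_eq_0:
  fixes v :: "'a::idom^'n::finite"
  assumes "(\<Sum>x\<in>A. v) = 0" and "of_nat (card A) \<noteq> (0::'a)"
  shows "v = 0"
proof -
  have "of_nat (card A) * v $ i = 0" for i
  proof -
    have "of_nat (card A) * v $ i = (\<Sum>x\<in>A. v $ i)" by (simp only: sum_constant)
    also have "\<dots> = (\<Sum>x\<in>A. v) $ i" by (simp only: sum_component)
    finally show ?thesis using assms(1) by (simp only: zero_index)
  qed
  with assms(2) show ?thesis by (simp only: vec_eq_iff zero_index mult_eq_0_iff) blast
qed

lemma sum_const_matrix_eq_0:
  fixes P :: "'a::idom^'n::finite^'m::finite"
  assumes "(\<Sum>x\<in>A. P) = 0" and "of_nat (card A) \<noteq> (0::'a)"
  shows "P = 0"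
proof -
  have "P $ i = 0" for i
  proof (rule sum_const_vec_eq_0)
    show "(\<Sum>x\<in>A. P $ i) = 0"
      using arg_cong[OF assms(1), of "\<lambda>Q. Q $ i"] by (simp only: sum_component zero_index)
  qed (fact assms(2))
  then show ?thesis by (simp add: vec_eq_iff)
qed

section \<open>Linear elements of M_n(k<x>)\<close>

definition nc_linear :: "(nat \<Rightarrow> 'a::field^'n::finite^'n) \<Rightarrow> ('a, 'n) ncmat" where
  "nc_linear f w = (case w of [a] \<Rightarrow> f a | _ \<Rightarrow> 0)"

lemma nc_linear_Cons_Cons [simp]: "nc_linear f (a # b # w) = 0"
  and nc_linear_Nil [simp]: "nc_linear f [] = 0"
  and nc_linear_single [simp]: "nc_linear f [a] = f a"
  by (simp_all add: nc_linear_def)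

lemma nc_var_eq_linear: "nc_var i = nc_linear (\<lambda>a. if a = i then mat 1 else 0)"
  by (rule ext, rename_tac w, case_tac w rule: remdups_adj.cases) (auto simp: nc_var_def)

lemma nc_mult_linear_Cons: "nc_mult (nc_linear f) P (a # w) = f a ** P w"
proof -
  let ?g = "\<lambda>k. nc_linear f (take k (a # w)) ** P (drop k (a # w))"
  have "(\<Sum>k\<le>length (a # w). ?g k) = ?g 1 + (\<Sum>k\<in>{..length (a # w)} - {1}. ?g k)"
    by (rule sum.remove) auto
  also have "(\<Sum>k\<in>{..length (a # w)} - {1}. ?g k) = 0"
    by (rule sum.neutral) (auto simp: nc_linear_def take_Cons' split: list.splits)
  finally show ?thesis by (simp add: nc_mult_def)
qed

lemma nc_mult_linear_Nil: "nc_mult (nc_linear f) P [] = 0"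
  by (simp add: nc_mult_def)

lemma nc_mult_var_const: "nc_mult (nc_var i) (nc_const A) = nc_linear (\<lambda>a. if a = i then A else 0)"
proof
  fix w
  show "nc_mult (nc_var i) (nc_const A) w = nc_linear (\<lambda>a. if a = i then A else 0) w"
    by (cases w rule: remdups_adj.cases)
      (auto simp: nc_var_eq_linear nc_mult_linear_Cons nc_mult_linear_Nil nc_const_def)
qed

lemma nc_sum_linear: "nc_sum (\<lambda>i. nc_linear (f i)) A = nc_linear (\<lambda>a. \<Sum>i\<in>A. f i a)"
  by (rule ext, rename_tac w, case_tac w rule: remdups_adj.cases) (simp_all add: nc_sum_def)

lemma nc_diff_linear: "nc_diff (nc_linear f) (nc_linear g) = nc_linear (\<lambda>a. f a - g a)"
  by (rule ext, rename_tac w, case_tac w rule: remdups_adj.cases) (simp_all add: nc_diff_def)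

fun linear_word_coeff :: "(nat \<Rightarrow> 'a::semiring_1^'n::finite^'n) list \<Rightarrow> nat list \<Rightarrow> 'a^'n^'n" where
  "linear_word_coeff [] [] = mat 1"
| "linear_word_coeff (f # fs) (a # w) = f a ** linear_word_coeff fs w"
| "linear_word_coeff _ _ = 0"

lemma nc_prod_list_map_linear: "nc_prod_list (map nc_linear fs) = linear_word_coeff fs"
proof (induction fs)
  case Nil
  show ?case by (rule ext, rename_tac w, case_tac w) (simp_all add: nc_prod_list_def nc_const_def)
next
  case (Cons f fs)
  then have "nc_prod_list (map nc_linear (f # fs)) = nc_mult (nc_linear f) (linear_word_coeff fs)"
    by (simp add: nc_prod_list_def)
  then show ?case
    by (intro ext, rename_tac w, case_tac w) (simp_all add: nc_mult_linear_Nil nc_mult_linear_Cons)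
qed

text \<open>The coefficients of the linear element T - x_j.\<close>

definition factor_coeff :: "nat \<Rightarrow> (nat \<Rightarrow> 'a::field^'n::finite^'n) \<Rightarrow> nat \<Rightarrow> nat \<Rightarrow> 'a^'n^'n" where
  "factor_coeff d \<alpha> j = (\<lambda>a. (if a \<in> {1..d} then \<alpha> a else 0) - (if a = j then mat 1 else 0))"

lemma T_mat_minus_var: "nc_diff (T_mat d \<alpha>) (nc_var j) = nc_linear (factor_coeff d \<alpha> j)"
  unfolding T_mat_def nc_mult_var_const
  by (simp add: nc_sum_linear nc_var_eq_linear nc_diff_linear
      factor_coeff_def if_distrib[of "\<lambda>x. x = _"] sum.delta cong: if_cong)

lemma chi_coeff:
  "chi d \<alpha> w
    = (\<Sum>\<sigma> | \<sigma> permutes {1..d}. linear_word_coeff (map (factor_coeff d \<alpha> \<circ> \<sigma>) [1..<d+1]) w)"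
proof -
  have "map (\<lambda>j. nc_diff (T_mat d \<alpha>) (nc_var (\<sigma> j))) js
      = map nc_linear (map (factor_coeff d \<alpha> \<circ> \<sigma>) js)"
    for \<sigma> :: "nat \<Rightarrow> nat" and js
    by (simp add: T_mat_minus_var)
  then show ?thesis by (simp only: chi_def nc_sum_def nc_prod_list_map_linear)
qed

section \<open>Vectors fixed by some \<alpha>_i\<close>

lemma linear_word_coeff_replicate_fixed_vector:
  assumes "i \<in> {1..d}" and "\<alpha> i *v m = m"
  shows "linear_word_coeff (map (factor_coeff d \<alpha>) js) (replicate (length js) i) *v m
    = (if i \<in> set js then 0 else m)"
proof (induction js)
  case (Cons j js)
  then show ?case
    using assms by (auto simp: factor_coeff_def matrix_vector_mult_diff_rdistrib
        simp flip: matrix_vector_mul_assoc)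
qed simp

lemma card_permutes_with_value:
  assumes "finite S" and "a \<notin> S" and "b \<in> insert a S"
  shows "card {p. p permutes insert a S \<and> p a = b} = fact (card S)"
proof -
  have fin: "finite {p. p permutes insert a S}" using assms(1) by (simp add: finite_permutations)
  have "card {p. p permutes insert a S \<and> p a = b}
      = card {p \<in> {p. p permutes insert a S}. p a = b}"
    by simp
  also have "\<dots> = (\<Sum>p | p permutes insert a S. if p a = b then 1 else 0)"
    by (simp only: card_eq_sum sum.inter_filter[OF fin])
  also have "\<dots> = (\<Sum>c\<in>insert a S. \<Sum>q | q permutes S.
      if (Transposition.transpose a c \<circ> q) a = b then 1 else 0)"
    by (rule sum_over_permutations_insert[OF assms(1,2)])
  also have "\<dots> = (\<Sum>c\<in>insert a S. \<Sum>q | q permutes S. if c = b then 1 else 0)"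
    using assms(2) by (intro sum.cong refl) (simp add: permutes_not_in)
  also have "\<dots> = (\<Sum>q | q permutes S. \<Sum>c\<in>insert a S. if c = b then 1 else 0)"
    by (rule sum.swap)
  also have "\<dots> = card {q. q permutes S}"
    using assms(1,3) by simp
  also have "\<dots> = fact (card S)"
    using assms(1) by (rule card_permutations[OF refl])
  finally show ?thesis .
qed

lemma chi_zero_imp_fixed_vector_kernel:
  fixes \<alpha> :: "nat \<Rightarrow> 'a::field^'n::finite^'n"
  assumes chi0: "chi d \<alpha> = nc_zero" and fact_ne_0: "of_nat (fact (d - 1)) \<noteq> (0::'a)"
    and i: "i \<in> {1..d}" and m: "\<alpha> i *v m = m" and j: "j \<in> {1..d}" "j \<noteq> i"
  shows "\<alpha> j *v m = 0"
proof -
  let ?w = "j # replicate (d - 1) i"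
  have coeff: "linear_word_coeff (map (factor_coeff d \<alpha> \<circ> \<sigma>) [1..<d+1]) ?w *v m
      = (if \<sigma> 1 = i then \<alpha> j *v m else 0)" if \<sigma>: "\<sigma> permutes {1..d}" for \<sigma>
  proof -
    let ?ks = "[2..<d+1]"
    have upt: "[1..<d+1] = 1 # ?ks"
      using i by (simp add: upt_conv_Cons numeral_2_eq_2 del: upt_Suc)
    have "set (map \<sigma> ?ks) = \<sigma> ` ({1..d} - {1})" by auto
    also have "\<dots> = {1..d} - {\<sigma> 1}"
      by (simp only: image_set_diff[OF permutes_inj[OF \<sigma>]] permutes_image[OF \<sigma>] image_insert
          image_empty)
    finally have kill: "(i \<in> set (map \<sigma> ?ks)) = (\<sigma> 1 \<noteq> i)" using i by auto
    have "linear_word_coeff (map (factor_coeff d \<alpha> \<circ> \<sigma>) [1..<d+1]) ?w *v m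
        = factor_coeff d \<alpha> (\<sigma> 1) j *v
            (linear_word_coeff (map (factor_coeff d \<alpha>) (map \<sigma> ?ks))
              (replicate (length (map \<sigma> ?ks)) i) *v m)"
      unfolding upt by (simp add: matrix_vector_mul_assoc del: upt_Suc)
    also have "\<dots> = factor_coeff d \<alpha> (\<sigma> 1) j *v (if \<sigma> 1 = i then m else 0)"
      by (simp only: linear_word_coeff_replicate_fixed_vector[of i d \<alpha> m, OF i m] kill) simp
    also have "\<dots> = (if \<sigma> 1 = i then \<alpha> j *v m else 0)"
      using j by (simp add: factor_coeff_def matrix_vector_mult_diff_rdistrib)
    finally show ?thesis .
  qed
  let ?P = "{\<sigma>. \<sigma> permutes {1..d}}"
  let ?P\<^sub>i = "{\<sigma> \<in> ?P. \<sigma> 1 = i}"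
  have "insert 1 {2..d} = {1..d}" using i by auto
  then have card: "card ?P\<^sub>i = fact (d - 1)"
    using card_permutes_with_value[of "{2..d}" 1 i] i by simp
  have "0 = chi d \<alpha> ?w *v m" using chi0 by (simp add: nc_zero_def)
  also have "\<dots> = (\<Sum>\<sigma>\<in>?P. if \<sigma> 1 = i then \<alpha> j *v m else 0)"
    by (simp only: chi_coeff matrix_vector_mult_sum_left) (intro sum.cong refl coeff, simp)
  also have "\<dots> = (\<Sum>\<sigma>\<in>?P\<^sub>i. \<alpha> j *v m)"
    by (rule sum.inter_filter[symmetric]) (simp add: finite_permutations)
  finally have "(\<Sum>\<sigma>\<in>?P\<^sub>i. \<alpha> j *v m) = 0" ..
  then show ?thesis
    by (rule sum_const_vec_eq_0) (simp only: card fact_ne_0 not_False_eq_True)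
qed

section \<open>Substituting commuting polynomials for the variables\<close>

definition poly_scaled :: "'a::comm_ring_1 poly \<Rightarrow> 'a^'n::finite^'n \<Rightarrow> 'a poly^'n^'n" where
  "poly_scaled c A = (\<chi> i j. smult (A $ i $ j) c)"

lemma poly_scaled_mult: "poly_scaled (c * c') (A ** B) = poly_scaled c A ** poly_scaled c' B"
  by (simp add: vec_eq_iff matrix_matrix_mult_def poly_scaled_def smult_sum mult_ac)

lemma poly_scaled_0 [simp]: "poly_scaled c 0 = 0"
  by (simp add: vec_eq_iff poly_scaled_def)

lemma poly_scaled_diff: "poly_scaled c (A - B) = poly_scaled c A - poly_scaled c B"
  by (simp add: vec_eq_iff poly_scaled_def smult_diff_left)

lemma poly_scaled_sum: "poly_scaled c (\<Sum>x\<in>S. A x) = (\<Sum>x\<in>S. poly_scaled c (A x))"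
  by (induction S rule: infinite_finite_induct)
    (simp_all add: vec_eq_iff poly_scaled_def smult_add_left)

lemma poly_scaled_mat: "poly_scaled c (mat a) = mat (smult a c)"
  by (simp add: vec_eq_iff poly_scaled_def mat_def)

fun sum_words :: "nat set \<Rightarrow> nat \<Rightarrow> (nat list \<Rightarrow> 'b::comm_monoid_add) \<Rightarrow> 'b" where
  "sum_words D 0 h = h []"
| "sum_words D (Suc n) h = (\<Sum>a\<in>D. sum_words D n (\<lambda>w. h (a # w)))"

lemma sum_words_zero: "sum_words D n (\<lambda>w. 0) = 0"
  by (induction n) simp_all

lemma sum_words_sum: "sum_words D n (\<lambda>w. \<Sum>s\<in>S. h s w) = (\<Sum>s\<in>S. sum_words D n (h s))"
  by (induction n arbitrary: h) (simp_all add: sum.swap[of _ D])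

lemma sum_words_mult_left: "sum_words D n (\<lambda>w. A ** h w) = A ** sum_words D n h"
  by (induction n arbitrary: h) (simp_all add: matrix_sum_ldistrib)

definition subst_linear ::
  "(nat \<Rightarrow> 'a::comm_ring_1 poly) \<Rightarrow> nat set \<Rightarrow> (nat \<Rightarrow> 'a^'n::finite^'n) \<Rightarrow> 'a poly^'n^'n" where
  "subst_linear t D f = (\<Sum>a\<in>D. poly_scaled (t a) (f a))"

text \<open>Substituting commuting polynomials t_a for the variables x_a is multiplicative.\<close>

lemma sum_words_subst_linear_word_coeff:
  "sum_words D (length fs) (\<lambda>w. poly_scaled (prod_list (map t w)) (linear_word_coeff fs w))
    = mat_prod_list (map (subst_linear t D) fs)"
proof (induction fs)
  case (Cons f fs)
  have "sum_words D (length (f # fs))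
        (\<lambda>w. poly_scaled (prod_list (map t w)) (linear_word_coeff (f # fs) w))
      = (\<Sum>a\<in>D. sum_words D (length fs)
           (\<lambda>w. poly_scaled (t a) (f a) ** poly_scaled (prod_list (map t w)) (linear_word_coeff fs w)))"
    by (simp add: poly_scaled_mult)
  also have "\<dots> = (\<Sum>a\<in>D. poly_scaled (t a) (f a) ** mat_prod_list (map (subst_linear t D) fs))"
    by (simp only: sum_words_mult_left Cons.IH)
  also have "\<dots> = subst_linear t D f ** mat_prod_list (map (subst_linear t D) fs)"
    by (simp only: subst_linear_def matrix_sum_rdistrib)
  finally show ?case by simp
qed (simp add: poly_scaled_mat one_pCons)

lemma subst_linear_factor_coeff:
  assumes "j \<in> {1..d}"
  shows "subst_linear t {1..d} (factor_coeff d \<alpha> j) = subst_linear t {1..d} \<alpha> - mat (t j)"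
proof -
  have "subst_linear t {1..d} (factor_coeff d \<alpha> j)
      = (\<Sum>a\<in>{1..d}. poly_scaled (t a) (\<alpha> a) - (if a = j then poly_scaled (t a) (mat 1) else 0))"
    by (auto simp: subst_linear_def factor_coeff_def poly_scaled_diff if_distrib[of "poly_scaled _"]
        intro: sum.cong)
  with assms show ?thesis by (simp add: sum_subtractf subst_linear_def poly_scaled_mat)
qed

lemma subst_chi:
  "sum_words {1..d} d (\<lambda>w. poly_scaled (prod_list (map t w)) (chi d \<alpha> w))
    = (\<Sum>\<sigma> | \<sigma> permutes {1..d}.
         mat_prod_list (map (\<lambda>k. subst_linear t {1..d} \<alpha> - mat (t k)) [1..<d+1]))"
    (is "_ = (\<Sum>\<sigma> | \<sigma> permutes {1..d}. mat_prod_list (map ?Q ?ks))")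
proof -
  let ?F = "\<lambda>\<sigma>. map (factor_coeff d \<alpha> \<circ> \<sigma>) ?ks"
  have reorder: "mat_prod_list (map (subst_linear t {1..d}) (?F \<sigma>)) = mat_prod_list (map ?Q ?ks)"
    if \<sigma>: "\<sigma> permutes {1..d}" for \<sigma>
  proof -
    have "\<sigma> k \<in> {1..d}" if "k \<in> set ?ks" for k
      using that permutes_in_image[OF \<sigma>] by (simp del: upt_Suc)
    then have "map (subst_linear t {1..d}) (?F \<sigma>) = map ?Q (map \<sigma> ?ks)"
      unfolding map_map by (intro map_cong refl) (simp only: o_apply subst_linear_factor_coeff)
    moreover have "mset (map \<sigma> ?ks) = mset ?ks"
      using permutes_image_mset[OF \<sigma>]
      by (simp add: mset_upt atLeastLessThanSuc_atLeastAtMost del: upt_Suc)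
    then have "mset (map ?Q (map \<sigma> ?ks)) = mset (map ?Q ?ks)"
      by (simp only: mset_map)
    then have "mat_prod_list (map ?Q (map \<sigma> ?ks)) = mat_prod_list (map ?Q ?ks)"
      by (rule mat_prod_list_perm) (clarsimp simp del: upt_Suc, rule diff_mat_commute)
    ultimately show ?thesis by (simp only:)
  qed
  have "sum_words {1..d} d (\<lambda>w. poly_scaled (prod_list (map t w)) (chi d \<alpha> w))
      = (\<Sum>\<sigma> | \<sigma> permutes {1..d}.
           sum_words {1..d} d (\<lambda>w. poly_scaled (prod_list (map t w)) (linear_word_coeff (?F \<sigma>) w)))"
    by (simp only: chi_coeff poly_scaled_sum sum_words_sum)
  also have "\<dots> = (\<Sum>\<sigma> | \<sigma> permutes {1..d}. mat_prod_list (map (subst_linear t {1..d}) (?F \<sigma>)))"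
  proof (rule sum.cong[OF refl])
    fix \<sigma>
    have "length (?F \<sigma>) = d" by simp
    then show "sum_words {1..d} d
          (\<lambda>w. poly_scaled (prod_list (map t w)) (linear_word_coeff (?F \<sigma>) w))
        = mat_prod_list (map (subst_linear t {1..d}) (?F \<sigma>))"
      using sum_words_subst_linear_word_coeff[of "{1..d}" "?F \<sigma>" t] by simp
  qed
  also have "\<dots> = (\<Sum>\<sigma> | \<sigma> permutes {1..d}. mat_prod_list (map ?Q ?ks))"
    by (intro sum.cong refl reorder) simp
  finally show ?thesis .
qed

section \<open>Lagrange interpolation below the characteristic\<close>

lemma of_nat_ne_0_below_char:
  assumes "CHAR('a::field) = 0 \<or> d < CHAR('a)" and "0 < k" and "k \<le> d"
  shows "of_nat k \<noteq> (0::'a)"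
  using assms by (auto simp: of_nat_eq_0_iff_char_dvd dest: dvd_imp_le)

lemma of_nat_fact_ne_0_below_char:
  assumes "CHAR('a::field) = 0 \<or> d < CHAR('a)" and "m \<le> d"
  shows "of_nat (fact m) \<noteq> (0::'a)"
proof -
  have "of_nat (fact m) = (\<Prod>k\<in>{1..m}. (of_nat k :: 'a))"
    by (simp add: fact_prod)
  with assms show ?thesis by (simp add: of_nat_ne_0_below_char)
qed

lemma of_nat_diff_ne_0_below_char:
  assumes "CHAR('a::field) = 0 \<or> d < CHAR('a)" and "i \<in> {1..d}" "l \<in> {1..d}" "i \<noteq> l"
  shows "of_nat i - of_nat l \<noteq> (0::'a)"
proof -
  have "of_nat (b - a) \<noteq> (0::'a)" if "a < b" "b \<le> d" for a b
    using that by (intro of_nat_ne_0_below_char[OF assms(1)]) auto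
  with assms(2-) show ?thesis
    by (cases "l < i") (auto simp: of_nat_diff dest: sym[of "of_nat i"] nat_neq_iff[THEN iffD1])
qed

definition lagrange_basis :: "nat \<Rightarrow> nat \<Rightarrow> 'a::field poly" where
  "lagrange_basis d i = smult (inverse (\<Prod>l\<in>{1..d} - {i}. of_nat i - of_nat l))
     (\<Prod>l\<in>{1..d} - {i}. [:- of_nat l, 1:])"

lemma poly_lagrange_basis:
  assumes "CHAR('a::field) = 0 \<or> d < CHAR('a)" and "i \<in> {1..d}" "j \<in> {1..d}"
  shows "poly (lagrange_basis d i :: 'a poly) (of_nat j) = (if i = j then 1 else 0)"
proof (cases "i = j")
  case True
  have "(\<Prod>l\<in>{1..d} - {i}. (of_nat i - of_nat l :: 'a)) \<noteq> 0"
    using of_nat_diff_ne_0_below_char[OF assms(1,2)] by auto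
  with True show ?thesis by (simp add: lagrange_basis_def poly_prod)
next
  case False
  with assms(3) have "(\<Prod>l\<in>{1..d} - {i}. (of_nat j - of_nat l :: 'a)) = 0"
    by (intro prod_zero) auto
  with False show ?thesis by (simp add: lagrange_basis_def poly_prod)
qed

lemma chi_zero_imp_det_eq_0:
  fixes \<alpha> :: "nat \<Rightarrow> 'a::field^'n::finite^'n"
  assumes char: "CHAR('a) = 0 \<or> d < CHAR('a)" and chi0: "chi d \<alpha> = nc_zero"
  shows "\<exists>k\<in>{1..d}. det (\<alpha> k - mat 1) = 0"
proof -
  let ?t = "lagrange_basis d :: nat \<Rightarrow> 'a poly"
  define Q where "Q = (\<lambda>k. subst_linear ?t {1..d} \<alpha> - mat (?t k))"
  have "(\<Sum>\<sigma> | \<sigma> permutes {1..d}. mat_prod_list (map Q [1..<d+1]))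
      = sum_words {1..d} d (\<lambda>w. poly_scaled (prod_list (map ?t w)) (chi d \<alpha> w))"
    unfolding Q_def by (rule subst_chi[symmetric])
  also have "\<dots> = 0"
    using chi0 by (simp add: nc_zero_def sum_words_zero)
  finally have "(\<Sum>\<sigma> | \<sigma> permutes {1..d}. mat_prod_list (map Q [1..<d+1])) = 0" .
  moreover have "of_nat (card {\<sigma>. \<sigma> permutes {1..d}}) \<noteq> (0 :: 'a poly)"
    using of_nat_fact_ne_0_below_char[OF char order.refl]
    by (simp add: card_permutations of_nat_poly)
  ultimately have "mat_prod_list (map Q [1..<d+1]) = 0"
    by (rule sum_const_matrix_eq_0)
  then have "prod_list (map det (map Q [1..<d+1])) = 0"
    by (simp only: det_mat_prod_list[symmetric] det_0[unfolded mat_0])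
  then obtain k where k: "k \<in> {1..d}" and "det (Q k) = 0"
    by (auto simp: prod_list_zero_iff less_Suc_eq_le simp del: upt_Suc)
  moreover have "map_matrix (\<lambda>p. poly p (of_nat k)) (Q k) = \<alpha> k - mat 1"
    using k poly_lagrange_basis[OF char _ k]
    by (simp add: vec_eq_iff Q_def subst_linear_def poly_scaled_def mat_def poly_sum
        if_distrib[of "\<lambda>x. _ * x"] cong: if_cong)
  ultimately show ?thesis
    using poly_det[of "Q k" "of_nat k"] by auto
qed

section \<open>The main theorem\<close>

theorem mainTheorem5:
  fixes d :: nat and \<alpha> :: "nat \<Rightarrow> 'a::field ^ 'n::finite ^ 'n"
  assumes char: "CHAR('a) = 0 \<or> CHAR('a) > d"
    and chi0: "chi d \<alpha> = nc_zero"
  shows "(\<exists>i\<in>{1..d}. \<exists>v :: 'a ^ 'n. v \<noteq> 0 \<and> \<alpha> i *v v = v)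
       \<and> (\<forall>i\<in>{1..d}. \<forall>m :: 'a ^ 'n. \<alpha> i *v m = m \<longrightarrow>
            (\<forall>j\<in>{1..d}. j \<noteq> i \<longrightarrow> \<alpha> j *v m = 0))"
proof
  obtain k where "k \<in> {1..d}" and "det (\<alpha> k - mat 1) = 0"
    using chi_zero_imp_det_eq_0[OF char chi0] by blast
  moreover obtain v where "v \<noteq> 0" and "(\<alpha> k - mat 1) *v v = 0"
    using det_eq_0_imp_kernel[OF calculation(2)] by blast
  ultimately show "\<exists>i\<in>{1..d}. \<exists>v :: 'a ^ 'n. v \<noteq> 0 \<and> \<alpha> i *v v = v"
    by (auto simp: matrix_vector_mult_diff_rdistrib)
  show "\<forall>i\<in>{1..d}. \<forall>m :: 'a ^ 'n. \<alpha> i *v m = m \<longrightarrow> (\<forall>j\<in>{1..d}. j \<noteq> i \<longrightarrow> \<alpha> j *v m = 0)"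
    using chi_zero_imp_fixed_vector_kernel[OF chi0 of_nat_fact_ne_0_below_char[OF char]] by auto
qed

end
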